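(* Let $\mathcal I$ and $\mathcal J$ be ideals on $\mathbb N$ with $\mathcal I\leq_K\mathcal J$, let $h\colon\mathbb N\to\mathbb N$ be an onto Katětov reduction from $\mathcal I$ to $\mathcal J$ (i.e. $h$ is onto and $h^{-1}(A)\in\mathcal J$ for all $A\in\mathcal I$), and let $T_h\colon c_{0,\mathcal I}\to c_{0,\mathcal J}$ be given by $T_h(\mathbf x)=\mathbf x\circ h$. Then: (1) $T_h$ is an into Banach lattice isometry. Moreover, it satisfies the following: (a) for each $n\in\mathbb N$ there is $A\in\mathcal I$ satisfying $T_h(\chi_A)(n)=1$; (b) for all $\emptyset\neq\mathcal F\subseteq\mathcal I$ such that $\bigcap_{A\in\mathcal F}A=\emptyset$, we have $\bigwedge_{A\in\mathcal F}T_h(\chi_A)=0$. (2) $h$ is bijective if and only if $T_h[c_{0,\mathcal I}]$ is an ideal of $c_{0,\mathcal J}$.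
   Context: An ideal on a set $S$ is a collection of subsets of $S$ containing $\emptyset$, closed under taking subsets and under finite unions; it is always assumed to contain every finite subset of $S$ (it need not be proper). $\mathcal I\leq_K\mathcal J$ (Katětov pre-order), for ideals on $\mathbb N$, means that there is $f\colon\mathbb N\to\mathbb N$ (a Katětov reduction) with $f^{-1}(A)\in\mathcal J$ for all $A\in\mathcal I$. For an ideal $\mathcal I$ on $\mathbb N$, $c_{0,\mathcal I}$ is the space of all bounded real sequences $(x_n)\in\ell_\infty$ such that $\{n\in\mathbb N: |x_n|\ge\varepsilon\}\in\mathcal I$ for every $\varepsilon>0$, with the sup norm and the pointwise order; it is a Banach lattice. $\chi_A$ is the characteristic function of $A$. An into Banach lattice isometry is a linear isometry $T$, not necessarily onto, with $T(x\wedge y)=Tx\wedge Ty$ for all $x,y$. A sublattice $Y$ of a Banach lattice $X$ is an ideal of $X$ if $x\in Y$ whenever $x\in X$ and $|x|\le|y|$ for some $y\in Y$. *)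

theory Defs
  imports "HOL-Analysis.Analysis" "HOL-Library.Lattice_Algebras" "HOL-Library.Lub_Glb"
begin

section \<open>Ideals of sets and the Katetov pre-order\<close>

definition set_ideal :: "'a set set \<Rightarrow> bool" where
  "set_ideal I \<longleftrightarrow>
     {} \<in> I \<and>
     (\<forall>A\<in>I. \<forall>B. B \<subseteq> A \<longrightarrow> B \<in> I) \<and>
     (\<forall>A\<in>I. \<forall>B\<in>I. A \<union> B \<in> I) \<and>
     (\<forall>A. finite A \<longrightarrow> A \<in> I)"

definition katetov_reduction :: "('b \<Rightarrow> 'a) \<Rightarrow> 'a set set \<Rightarrow> 'b set set \<Rightarrow> bool" where
  "katetov_reduction f I J \<longleftrightarrow> (\<forall>A\<in>I. f -` A \<in> J)"

definition katetov_le :: "'a set set \<Rightarrow> 'b set set \<Rightarrow> bool" (infix \<open>\<le>\<^sub>K\<close> 50) where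
  "I \<le>\<^sub>K J \<longleftrightarrow> (\<exists>f. katetov_reduction f I J)"


section \<open>Banach lattices\<close>

class banach_lattice = banach + ordered_real_vector + lattice_ab_group_add_abs +
  assumes norm_mono_abs: "\<bar>x\<bar> \<le> \<bar>y\<bar> \<Longrightarrow> norm x \<le> norm y"

instance real :: banach_lattice
  by standard simp

text \<open>
  Banach lattices other than whole types are represented by carrier sets that are (closed)
  sublattices of a type of class \<^class>\<open>banach_lattice\<close>, with the norm, the order and the
  operations inherited from that type.
\<close>

definition sublattice :: "'a::banach_lattice set \<Rightarrow> bool" where
  "sublattice Y \<longleftrightarrow> subspace Y \<and> (\<forall>x\<in>Y. \<forall>y\<in>Y. inf x y \<in> Y \<and> sup x y \<in> Y)"

definition lattice_ideal :: "'a::banach_lattice set \<Rightarrow> 'a set \<Rightarrow> bool" where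
  "lattice_ideal Y X \<longleftrightarrow>
     Y \<subseteq> X \<and> sublattice Y \<and> (\<forall>x\<in>X. \<forall>y\<in>Y. \<bar>x\<bar> \<le> \<bar>y\<bar> \<longrightarrow> x \<in> Y)"

definition into_banach_lattice_isometry ::
    "'a::banach_lattice set \<Rightarrow> 'b::banach_lattice set \<Rightarrow> ('a \<Rightarrow> 'b) \<Rightarrow> bool" where
  "into_banach_lattice_isometry X Y T \<longleftrightarrow>
     T ` X \<subseteq> Y \<and>
     (\<forall>x\<in>X. \<forall>y\<in>X. T (x + y) = T x + T y) \<and>
     (\<forall>x\<in>X. \<forall>c. T (c *\<^sub>R x) = c *\<^sub>R T x) \<and>
     (\<forall>x\<in>X. norm (T x) = norm x) \<and>
     (\<forall>x\<in>X. \<forall>y\<in>X. T (inf x y) = inf (T x) (T y))"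


section \<open>Bounded continuous functions with the pointwise order\<close>

instantiation bcontfun :: (topological_space, "{metric_space, linorder_topology}") lattice
begin

context includes bcontfun.lifting begin

lift_definition less_eq_bcontfun :: "('a \<Rightarrow>\<^sub>C 'b) \<Rightarrow> ('a \<Rightarrow>\<^sub>C 'b) \<Rightarrow> bool"
  is "\<lambda>f g. \<forall>x. f x \<le> g x" .

lift_definition inf_bcontfun :: "('a \<Rightarrow>\<^sub>C 'b) \<Rightarrow> ('a \<Rightarrow>\<^sub>C 'b) \<Rightarrow> ('a \<Rightarrow>\<^sub>C 'b)"
  is "\<lambda>f g x. min (f x) (g x)"
proof -
  fix f g :: "'a \<Rightarrow> 'b" assume fg: "f \<in> bcontfun" "g \<in> bcontfun"
  have "range (\<lambda>x. min (f x) (g x)) \<subseteq> range f \<union> range g"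
    by (auto simp: min_def)
  with fg show "(\<lambda>x. min (f x) (g x)) \<in> bcontfun"
    by (auto simp: bcontfun_def intro!: continuous_intros intro: bounded_subset[OF bounded_Un[THEN iffD2]])
qed

lift_definition sup_bcontfun :: "('a \<Rightarrow>\<^sub>C 'b) \<Rightarrow> ('a \<Rightarrow>\<^sub>C 'b) \<Rightarrow> ('a \<Rightarrow>\<^sub>C 'b)"
  is "\<lambda>f g x. max (f x) (g x)"
proof -
  fix f g :: "'a \<Rightarrow> 'b" assume fg: "f \<in> bcontfun" "g \<in> bcontfun"
  have "range (\<lambda>x. max (f x) (g x)) \<subseteq> range f \<union> range g"
    by (auto simp: max_def)
  with fg show "(\<lambda>x. max (f x) (g x)) \<in> bcontfun"
    by (auto simp: bcontfun_def intro!: continuous_intros intro: bounded_subset[OF bounded_Un[THEN iffD2]])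
qed

end

definition less_bcontfun :: "('a \<Rightarrow>\<^sub>C 'b) \<Rightarrow> ('a \<Rightarrow>\<^sub>C 'b) \<Rightarrow> bool"
  where "less_bcontfun f g \<longleftrightarrow> f \<le> g \<and> \<not> g \<le> f"

lemmas [simp] = inf_bcontfun.rep_eq sup_bcontfun.rep_eq

instance
  by standard
    (auto simp: less_bcontfun_def less_eq_bcontfun.rep_eq intro: order_trans intro!: bcontfun_eqI order_antisym)

end

text \<open>
  The library proves completeness only over a metric domain, which \<^typ>\<open>nat\<close> is not declared to be.
\<close>

instance bcontfun :: (topological_space, complete_space) complete_space
proof
  fix f :: "nat \<Rightarrow> ('a, 'b) bcontfun"
  assume "Cauchy f"
  then obtain g where "uniform_limit UNIV f g sequentially"
    using uniformly_convergent_eq_cauchy[of "\<lambda>_. True" f]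
    unfolding Cauchy_def uniform_limit_sequentially_iff
    by (metis dist_fun_lt_imp_dist_val_lt)
  from uniform_limit_bcontfunE[OF this sequentially_bot]
  show "convergent f"
    by (metis convergentI)
qed

instance bcontfun :: (topological_space, banach) banach ..

instantiation bcontfun :: (topological_space, "{banach_lattice, linorder_topology}") banach_lattice
begin

definition abs_bcontfun :: "('a \<Rightarrow>\<^sub>C 'b) \<Rightarrow> ('a \<Rightarrow>\<^sub>C 'b)"
  where "abs_bcontfun f = sup f (- f)"

lemma apply_bcontfun_abs [simp]: "apply_bcontfun \<bar>f\<bar> x = \<bar>apply_bcontfun f x\<bar>"
  for f :: "'a \<Rightarrow>\<^sub>C 'b"
  by (simp add: abs_bcontfun_def abs_lattice sup_max)

instance
proof
  fix f g :: "'a \<Rightarrow>\<^sub>C 'b"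
  assume "\<bar>f\<bar> \<le> \<bar>g\<bar>"
  then have "norm (apply_bcontfun f x) \<le> norm (apply_bcontfun g x)" for x
    by (intro norm_mono_abs) (simp add: less_eq_bcontfun.rep_eq)
  then show "norm f \<le> norm g"
    by (intro norm_bound) (meson norm_bounded order_trans)
qed (auto simp: less_eq_bcontfun.rep_eq abs_bcontfun_def scaleR_left_mono scaleR_right_mono)

end


section \<open>The Banach lattice \<open>c\<^sub>0\<^sub>,\<^sub>I\<close>\<close>

text \<open>
  Since \<^typ>\<open>nat\<close> is discrete, \<^typ>\<open>nat \<Rightarrow>\<^sub>C real\<close> is the space of all bounded real
  sequences with the sup norm.
\<close>

definition c0 :: "nat set set \<Rightarrow> (nat \<Rightarrow>\<^sub>C real) set" where
  "c0 I = {x. \<forall>\<epsilon>>0. {n. \<bar>apply_bcontfun x n\<bar> \<ge> \<epsilon>} \<in> I}"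

context includes bcontfun.lifting begin

lift_definition chi :: "nat set \<Rightarrow> (nat \<Rightarrow>\<^sub>C real)" is "\<lambda>A. indicator A"
  by (rule bcontfun_normI[of _ 1]) (auto simp: indicator_def)

lift_definition comp_op :: "(nat \<Rightarrow> nat) \<Rightarrow> (nat \<Rightarrow>\<^sub>C real) \<Rightarrow> (nat \<Rightarrow>\<^sub>C real)"
  is "\<lambda>h x. x \<circ> h"
  by (auto simp: bcontfun_def intro: bounded_subset)

end

lemma sublattice_c0:
  assumes "set_ideal I"
  shows "sublattice (c0 I)"
proof -
  have sub: "A \<in> I \<Longrightarrow> B \<subseteq> A \<Longrightarrow> B \<in> I" and un: "A \<in> I \<Longrightarrow> B \<in> I \<Longrightarrow> A \<union> B \<in> I"
    and emp: "{} \<in> I" for A B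
    using assms unfolding set_ideal_def by blast+
  have dom: "z \<in> c0 I" if "x \<in> c0 I" "y \<in> c0 I" "C > 0"
    and le: "\<And>n. \<bar>apply_bcontfun z n\<bar> \<le> C * max \<bar>apply_bcontfun x n\<bar> \<bar>apply_bcontfun y n\<bar>"
    for x y z C
    unfolding c0_def
  proof safe
    fix e :: real assume "e > 0"
    with \<open>C > 0\<close> have "e / C > 0" by simp
    with that have un': "{n. \<bar>apply_bcontfun x n\<bar> \<ge> e / C} \<union> {n. \<bar>apply_bcontfun y n\<bar> \<ge> e / C} \<in> I"
      unfolding c0_def by (blast intro: un)
    have "e / C \<le> max \<bar>apply_bcontfun x n\<bar> \<bar>apply_bcontfun y n\<bar>"
      if "e \<le> \<bar>apply_bcontfun z n\<bar>" for n
      using order_trans[OF that le] \<open>C > 0\<close> by (simp add: divide_le_eq mult.commute)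
    then show "{n. \<bar>apply_bcontfun z n\<bar> \<ge> e} \<in> I"
      by (intro sub[OF un']) (auto simp: le_max_iff_disj)
  qed
  have "0 \<in> c0 I" by (auto simp: c0_def emp)
  moreover have "x + y \<in> c0 I" if "x \<in> c0 I" "y \<in> c0 I" for x y
    by (rule dom[OF that, of 2]) auto
  moreover have "c *\<^sub>R x \<in> c0 I" if "x \<in> c0 I" for c x
    by (rule dom[OF that that, of "\<bar>c\<bar> + 1"]) (auto simp: abs_mult intro: mult_right_mono)
  moreover have "inf x y \<in> c0 I" if "x \<in> c0 I" "y \<in> c0 I" for x y
    by (rule dom[OF that, of 1]) auto
  moreover have "sup x y \<in> c0 I" if "x \<in> c0 I" "y \<in> c0 I" for x y
    by (rule dom[OF that, of 1]) auto
  ultimately show ?thesis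
    unfolding sublattice_def subspace_def by (intro conjI ballI allI)
qed

lemma closed_c0:
  assumes "set_ideal I"
  shows "closed (c0 I)"
  unfolding closure_subset_eq[symmetric]
proof
  fix x assume "x \<in> closure (c0 I)"
  then have x: "\<forall>e>0. \<exists>y\<in>c0 I. dist y x < e"
    by (simp add: closure_approachable)
  show "x \<in> c0 I"
    unfolding c0_def
  proof safe
    fix e :: real assume "e > 0"
    then obtain y where y: "y \<in> c0 I" "dist y x < e / 2"
      using x half_gt_zero by blast
    have "{n. \<bar>apply_bcontfun x n\<bar> \<ge> e} \<subseteq> {n. \<bar>apply_bcontfun y n\<bar> \<ge> e / 2}"
    proof safe
      fix n assume "e \<le> \<bar>apply_bcontfun x n\<bar>"
      moreover have "\<bar>apply_bcontfun y n - apply_bcontfun x n\<bar> < e / 2"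
        using dist_fun_lt_imp_dist_val_lt[OF y(2), of n] by (simp add: dist_real_def)
      ultimately show "e / 2 \<le> \<bar>apply_bcontfun y n\<bar>" by linarith
    qed
    moreover have "{n. \<bar>apply_bcontfun y n\<bar> \<ge> e / 2} \<in> I"
      using y(1) half_gt_zero[OF \<open>e > 0\<close>] unfolding c0_def by blast
    ultimately show "{n. \<bar>apply_bcontfun x n\<bar> \<ge> e} \<in> I"
      using assms unfolding set_ideal_def by blast
  qed
qed

end

theory Submission
  imports Defs
begin

text \<open>Composition with \<open>h\<close> acts pointwise, so it respects all lattice and vector
  operations. It preserves the sup norm because \<open>h\<close> is onto, and it lands in
  \<open>c0 J\<close> because the level sets of \<open>x o h\<close> are the preimages under
  \<open>h\<close> of those of \<open>x\<close>. Singletons belong to \<open>I\<close>, which gives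
  (a); (b) is checked coordinate by coordinate. For (2), only injectivity is at stake. If
  \<open>h\<close> is bijective, anything dominated by \<open>x o h\<close> can be pulled back along
  the inverse of \<open>h\<close> to something dominated by \<open>x\<close>
  (\<open>lattice_ideal_comp_op_image\<close>). If \<open>h\<close> identifies two points, the image
  cannot separate them, although an ideal would have to contain the characteristic function of one
  of them (\<open>inj_if_lattice_ideal_comp_op_image\<close>).\<close>

lemmas apply_comp_op [simp] = comp_op.rep_eq

lemma apply_chi [simp]: "apply_bcontfun (chi A) n = indicator A n"
  by (simp add: chi.rep_eq)

lemma bcontfun_less_eq_iff:
  fixes x y :: "'a::topological_space \<Rightarrow>\<^sub>C real"
  shows "x \<le> y \<longleftrightarrow> (\<forall>n. apply_bcontfun x n \<le> apply_bcontfun y n)"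
  by (rule less_eq_bcontfun.rep_eq)

lemma comp_op_add: "comp_op h (x + y) = comp_op h x + comp_op h y"
  and comp_op_scaleR: "comp_op h (c *\<^sub>R x) = c *\<^sub>R comp_op h x"
  and comp_op_inf: "comp_op h (inf x y) = inf (comp_op h x) (comp_op h y)"
  and comp_op_sup: "comp_op h (sup x y) = sup (comp_op h x) (comp_op h y)"
  by (rule bcontfun_eqI; simp)+

text \<open>Since \<open>h\<close> is onto, \<open>x\<close> and \<open>x o h\<close> have the same
  range; each norm therefore bounds the values of the other function.\<close>

lemma norm_comp_op:
  assumes "surj h"
  shows "norm (comp_op h x) = norm x"
proof (rule antisym)
  show "norm (comp_op h x) \<le> norm x"
    using norm_bounded[of x] by (intro norm_bound) simp
  show "norm x \<le> norm (comp_op h x)"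
  proof (rule norm_bound)
    fix n
    obtain m where "n = h m" using assms by (rule surjE)
    then show "norm (apply_bcontfun x n) \<le> norm (comp_op h x)"
      using norm_bounded[of "comp_op h x" m] by simp
  qed
qed

lemma comp_op_in_c0:
  assumes "katetov_reduction h I J" "x \<in> c0 I"
  shows "comp_op h x \<in> c0 J"
  unfolding c0_def
proof safe
  fix e :: real assume "e > 0"
  then have "h -` {n. \<bar>apply_bcontfun x n\<bar> \<ge> e} \<in> J"
    using assms unfolding katetov_reduction_def c0_def by blast
  then show "{n. \<bar>apply_bcontfun (comp_op h x) n\<bar> \<ge> e} \<in> J"
    by (simp add: vimage_def)
qed

text \<open>Level sets of \<open>y\<close> lie inside those of \<open>x\<close>. This places the
  pulled-back function of the bijective case in \<open>c0 I\<close>.\<close>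

lemma c0_solid:
  assumes "set_ideal I" "x \<in> c0 I" "\<bar>y\<bar> \<le> \<bar>x\<bar>"
  shows "y \<in> c0 I"
  unfolding c0_def
proof safe
  fix e :: real assume "e > 0"
  then have "{n. \<bar>apply_bcontfun x n\<bar> \<ge> e} \<in> I"
    using assms(2) unfolding c0_def by blast
  moreover have "{n. \<bar>apply_bcontfun y n\<bar> \<ge> e} \<subseteq> {n. \<bar>apply_bcontfun x n\<bar> \<ge> e}"
    using assms(3) by (auto simp: bcontfun_less_eq_iff intro: order_trans)
  ultimately show "{n. \<bar>apply_bcontfun y n\<bar> \<ge> e} \<in> I"
    using assms(1) unfolding set_ideal_def by blast
qed

lemma chi_in_c0:
  assumes "set_ideal I" "A \<in> I"
  shows "chi A \<in> c0 I"
  unfolding c0_def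
proof safe
  fix e :: real assume "e > 0"
  then have "{n. \<bar>apply_bcontfun (chi A) n\<bar> \<ge> e} \<subseteq> A"
    by (auto simp: indicator_def split: if_splits)
  then show "{n. \<bar>apply_bcontfun (chi A) n\<bar> \<ge> e} \<in> I"
    using assms unfolding set_ideal_def by blast
qed

lemma into_banach_lattice_isometry_comp_op:
  assumes "surj h" "katetov_reduction h I J"
  shows "into_banach_lattice_isometry (c0 I) (c0 J) (comp_op h)"
  using assms unfolding into_banach_lattice_isometry_def
  by (auto simp: comp_op_add comp_op_scaleR comp_op_inf norm_comp_op comp_op_in_c0)

lemma sublattice_comp_op_image:
  assumes "sublattice X"
  shows "sublattice (comp_op h ` X)"
proof -
  have "linear (comp_op h)"
    by (rule linearI) (simp_all add: comp_op_add comp_op_scaleR)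
  then have "subspace (comp_op h ` X)"
    using assms unfolding sublattice_def by (blast intro: linear_subspace_image)
  with assms show ?thesis
    unfolding sublattice_def
    by (auto simp: comp_op_inf[symmetric] comp_op_sup[symmetric])
qed

lemma isGlb_comp_op_chi:
  assumes "set_ideal J" "\<Inter> F = {}"
  shows "isGlb (c0 J) ((\<lambda>A. comp_op h (chi A)) ` F) 0"
proof -
  have "0 \<in> c0 J"
    using sublattice_c0[OF assms(1)] unfolding sublattice_def by (blast intro: subspace_0)
  moreover have "y \<le> 0" if y: "\<And>A. A \<in> F \<Longrightarrow> y \<le> comp_op h (chi A)" for y
    unfolding bcontfun_less_eq_iff
  proof
    fix n
    \<comment> \<open>Some member of \<open>F\<close> misses \<open>h n\<close>, so its pulled-back
      characteristic function vanishes at \<open>n\<close> and forces the lower bound to be at most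
      0 there.\<close>
    obtain A where "A \<in> F" "h n \<notin> A" using assms(2) by blast
    with y[of A] show "apply_bcontfun y n \<le> apply_bcontfun 0 n"
      by (auto simp: bcontfun_less_eq_iff dest!: spec[of _ n])
  qed
  moreover have "0 \<le> comp_op h (chi A)" for A
    by (simp add: bcontfun_less_eq_iff)
  ultimately show ?thesis
    unfolding isGlb_def greatestP_def isLb_def setle_def setge_def by auto
qed

lemma lattice_ideal_comp_op_image:
  assumes "set_ideal I" "bij h" "katetov_reduction h I J"
  shows "lattice_ideal (comp_op h ` c0 I) (c0 J)"
  unfolding lattice_ideal_def
proof (intro conjI ballI impI)
  show "comp_op h ` c0 I \<subseteq> c0 J"
    using assms(3) by (auto intro: comp_op_in_c0)
  show "sublattice (comp_op h ` c0 I)"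
    using assms(1) by (intro sublattice_comp_op_image sublattice_c0)
next
  fix y z assume "z \<in> comp_op h ` c0 I" and le: "\<bar>y\<bar> \<le> \<bar>z\<bar>"
  then obtain x where x: "x \<in> c0 I" and z: "z = comp_op h x" by blast
  have surj: "h (inv h n) = n" and inj: "inv h (h n) = n" for n
    using assms(2) by (simp_all add: bij_is_surj surj_f_inv_f bij_is_inj)
  \<comment> \<open>The only candidate for a preimage of \<open>y\<close> is
    \<open>y o inv h\<close>; evaluating the given domination at \<open>inv h n\<close> bounds it by
    \<open>x\<close> at \<open>n\<close>.\<close>
  have "\<bar>comp_op (inv h) y\<bar> \<le> \<bar>x\<bar>"
    unfolding bcontfun_less_eq_iff
  proof
    fix n
    show "apply_bcontfun \<bar>comp_op (inv h) y\<bar> n \<le> apply_bcontfun \<bar>x\<bar> n"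
      using le surj[of n] by (auto simp: z bcontfun_less_eq_iff dest!: spec[of _ "inv h n"])
  qed
  then have "comp_op (inv h) y \<in> c0 I"
    by (rule c0_solid[OF assms(1) x])
  moreover have "y = comp_op h (comp_op (inv h) y)"
    by (rule bcontfun_eqI) (simp add: inj)
  ultimately show "y \<in> comp_op h ` c0 I" by blast
qed

text \<open>
  If \<open>h a = h b\<close>, the image contains \<open>\<chi>\<^bsub>{h a}\<^esub> \<circ> h\<close>, hence the smaller function \<open>\<chi>\<^bsub>{a}\<^esub>\<close>,
  and every function in the image takes equal values at \<open>a\<close> and \<open>b\<close>.
\<close>

lemma inj_if_lattice_ideal_comp_op_image:
  assumes "set_ideal I" "set_ideal J" "lattice_ideal (comp_op h ` c0 I) (c0 J)"
  shows "inj h"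
proof (rule injI)
  fix a b assume ab: "h a = h b"
  have singleton: "{k} \<in> I" "{k} \<in> J" for k
    using assms(1,2) by (simp_all add: set_ideal_def)
  have "\<bar>chi {a}\<bar> \<le> \<bar>comp_op h (chi {h a})\<bar>"
    by (auto simp: bcontfun_less_eq_iff indicator_def)
  moreover have "chi {a} \<in> c0 J" "chi {h a} \<in> c0 I"
    using assms(1,2) singleton by (simp_all add: chi_in_c0)
  ultimately have "chi {a} \<in> comp_op h ` c0 I"
    using assms(3) unfolding lattice_ideal_def by blast
  then obtain x where x: "chi {a} = comp_op h x" by blast
  have "apply_bcontfun (chi {a}) a = apply_bcontfun (chi {a}) b"
    unfolding x by (simp add: ab)
  then show "a = b"
    by (auto simp: indicator_def split: if_splits)
qed

theorem proposition3p5: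
  fixes I J :: "nat set set" and h :: "nat \<Rightarrow> nat"
  assumes "set_ideal I" and "set_ideal J" and "I \<le>\<^sub>K J"
    and "surj h" and "katetov_reduction h I J"
  shows "(into_banach_lattice_isometry (c0 I) (c0 J) (comp_op h) \<and>
          (\<forall>n. \<exists>A\<in>I. apply_bcontfun (comp_op h (chi A)) n = 1) \<and>
          (\<forall>F. F \<noteq> {} \<and> F \<subseteq> I \<and> \<Inter> F = {} \<longrightarrow>
               isGlb (c0 J) ((\<lambda>A. comp_op h (chi A)) ` F) 0)) \<and>
         (bij h \<longleftrightarrow> lattice_ideal (comp_op h ` c0 I) (c0 J))"
proof (intro conjI allI impI)
  show "into_banach_lattice_isometry (c0 I) (c0 J) (comp_op h)"
    using assms by (intro into_banach_lattice_isometry_comp_op)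
next
  fix n
  have "{h n} \<in> I" using assms(1) by (simp add: set_ideal_def)
  moreover have "apply_bcontfun (comp_op h (chi {h n})) n = 1" by simp
  ultimately show "\<exists>A\<in>I. apply_bcontfun (comp_op h (chi A)) n = 1" by blast
next
  fix F assume "F \<noteq> {} \<and> F \<subseteq> I \<and> \<Inter> F = {}"
  then show "isGlb (c0 J) ((\<lambda>A. comp_op h (chi A)) ` F) 0"
    using assms(2) by (intro isGlb_comp_op_chi) auto
next
  \<comment> \<open>As \<open>h\<close> is onto by assumption, bijectivity amounts to
    injectivity.\<close>
  show "bij h \<longleftrightarrow> lattice_ideal (comp_op h ` c0 I) (c0 J)"
    using assms lattice_ideal_comp_op_image inj_if_lattice_ideal_comp_op_image
    unfolding bij_def by blast
qed

end
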